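(* The Lipschitz-free space $\mathcal{F}(\mathbb{Z}_{\ell_1})$ is linearly isomorphic to its countable $\ell_1$-sum $\left(\bigoplus_{\mathbb{N}}\mathcal{F}(\mathbb{Z}_{\ell_1})\right)_1$.
   Context: $\ell_1$ is the real Banach space of absolutely summable sequences with its standard basis $(e_n)_{n\in\mathbb{N}}$. The integer grid $\mathbb{Z}_{\ell_1}$ is the set of all finite linear combinations $\sum_{n=1}^N a_ne_n$ with $N\in\mathbb{N}$ and $a_n\in\mathbb{Z}$ for all $n$, equipped with the metric induced by the $\ell_1$-norm. For a metric space $M$ with a chosen base point $0\in M$, $\mathrm{Lip}_0(M)$ is the Banach space of Lipschitz functions $f:M\to\mathbb{R}$ with $f(0)=0$, normed by the best Lipschitz constant. The Lipschitz-free space is $\mathcal{F}(M)=\overline{\mathrm{span}}\{\delta(x):x\in M\}\subset \mathrm{Lip}_0(M)^*$, where $\delta(x)(f)=f(x)$. $\left(\bigoplus_{\mathbb{N}}Y\right)_1$ denotes the $\ell_1$-sum of countably infinitely many copies of a Banach space $Y$. *)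

theory Defs
  imports "HOL-Analysis.Analysis"
begin

section \<open>Countable \<open>\<ell>\<^sub>1\<close>-sums\<close>

typedef (overloaded) 'b l1_sum = "{x :: nat \<Rightarrow> 'b::real_normed_vector. summable (\<lambda>n. norm (x n))}"
  morphisms l1_nth Abs_l1_sum
  by (rule exI[of _ "\<lambda>_. 0"]) simp

setup_lifting type_definition_l1_sum

lemma summable_l1_nth: "summable (\<lambda>n. norm (l1_nth x n))"
  using l1_nth by blast

instantiation l1_sum :: (real_normed_vector) real_normed_vector
begin

lift_definition zero_l1_sum :: "'a l1_sum" is "\<lambda>_. 0" by simp

lift_definition plus_l1_sum :: "'a l1_sum \<Rightarrow> 'a l1_sum \<Rightarrow> 'a l1_sum" is "\<lambda>x y n. x n + y n"
  by (rule summable_comparison_test'[OF summable_add, where N = 0])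
     (assumption, assumption, simp add: norm_triangle_ineq)

lift_definition uminus_l1_sum :: "'a l1_sum \<Rightarrow> 'a l1_sum" is "\<lambda>x n. - x n" by simp

lift_definition minus_l1_sum :: "'a l1_sum \<Rightarrow> 'a l1_sum \<Rightarrow> 'a l1_sum" is "\<lambda>x y n. x n - y n"
  by (rule summable_comparison_test'[OF summable_add, where N = 0])
     (assumption, assumption, simp add: norm_triangle_ineq4)

lift_definition scaleR_l1_sum :: "real \<Rightarrow> 'a l1_sum \<Rightarrow> 'a l1_sum" is "\<lambda>c x n. c *\<^sub>R x n"
  by (auto intro: summable_mult)

lift_definition norm_l1_sum :: "'a l1_sum \<Rightarrow> real" is "\<lambda>x. \<Sum>n. norm (x n)" .

definition dist_l1_sum :: "'a l1_sum \<Rightarrow> 'a l1_sum \<Rightarrow> real"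
  where "dist_l1_sum x y = norm (x - y)"

definition sgn_l1_sum :: "'a l1_sum \<Rightarrow> 'a l1_sum"
  where "sgn_l1_sum x = inverse (norm x) *\<^sub>R x"

definition uniformity_l1_sum :: "('a l1_sum \<times> 'a l1_sum) filter"
  where "uniformity_l1_sum = (INF e\<in>{0<..}. principal {(x, y). dist x y < e})"

definition open_l1_sum :: "'a l1_sum set \<Rightarrow> bool"
  where "open_l1_sum U \<longleftrightarrow> (\<forall>x\<in>U. \<forall>\<^sub>F (x', y) in uniformity. x' = x \<longrightarrow> y \<in> U)"

instance
proof
  fix x y :: "'a l1_sum" and a :: real
  show "norm x = 0 \<longleftrightarrow> x = 0"
    by transfer (auto simp: suminf_eq_zero_iff fun_eq_iff)
  show "norm (x + y) \<le> norm x + norm y"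
  proof transfer
    fix x y :: "nat \<Rightarrow> 'a"
    assume x: "summable (\<lambda>n. norm (x n))" and y: "summable (\<lambda>n. norm (y n))"
    have "summable (\<lambda>n. norm (x n + y n))"
      by (rule summable_comparison_test'[OF summable_add[OF x y]]) (auto intro: norm_triangle_ineq)
    then have "(\<Sum>n. norm (x n + y n)) \<le> (\<Sum>n. norm (x n) + norm (y n))"
      by (intro suminf_le summable_add x y norm_triangle_ineq)
    then show "(\<Sum>n. norm (x n + y n)) \<le> (\<Sum>n. norm (x n)) + (\<Sum>n. norm (y n))"
      by (simp add: suminf_add x y)
  qed
  show "norm (a *\<^sub>R x) = \<bar>a\<bar> * norm x"
    by transfer (simp add: suminf_mult)
qed (simp_all add: dist_l1_sum_def sgn_l1_sum_def uniformity_l1_sum_def open_l1_sum_def,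
     (transfer, simp add: fun_eq_iff algebra_simps)+)

end

lemma norm_l1_nth_le: "norm (l1_nth x n) \<le> norm x"
proof -
  have "sum (\<lambda>n. norm (l1_nth x n)) {n} \<le> (\<Sum>n. norm (l1_nth x n))"
    by (intro sum_le_suminf summable_l1_nth) auto
  then show ?thesis by (simp add: norm_l1_sum.rep_eq)
qed

instance l1_sum :: (banach) banach
proof
  fix X :: "nat \<Rightarrow> 'a l1_sum"
  assume X: "Cauchy X"
  have "Cauchy (\<lambda>m. l1_nth (X m) n)" for n
  proof (rule metric_CauchyI)
    fix e :: real assume "e > 0"
    then obtain M where M: "\<forall>m\<ge>M. \<forall>k\<ge>M. dist (X m) (X k) < e"
      using X by (meson metric_CauchyD)
    have "dist (l1_nth (X m) n) (l1_nth (X k) n) < e" if "m \<ge> M" "k \<ge> M" for m k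
      using norm_l1_nth_le[of "X m - X k" n] M that
      by (force simp: dist_norm minus_l1_sum.rep_eq)
    then show "\<exists>M. \<forall>m\<ge>M. \<forall>k\<ge>M. dist (l1_nth (X m) n) (l1_nth (X k) n) < e" by blast
  qed
  then obtain y where y: "\<And>n. (\<lambda>m. l1_nth (X m) n) \<longlonglongrightarrow> y n"
    unfolding Cauchy_convergent_iff convergent_def by metis
  have bound: "\<exists>M. \<forall>m\<ge>M. \<forall>K. (\<Sum>n<K. norm (l1_nth (X m) n - y n)) \<le> e" if "e > 0" for e :: real
  proof -
    obtain M where M: "\<And>m k. m \<ge> M \<Longrightarrow> k \<ge> M \<Longrightarrow> dist (X m) (X k) < e"
      using X \<open>e > 0\<close> by (meson metric_CauchyD)
    have "(\<Sum>n<K. norm (l1_nth (X m) n - y n)) \<le> e" if m: "m \<ge> M" for m K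
    proof (rule LIMSEQ_le_const2)
      show "(\<lambda>k. \<Sum>n<K. norm (l1_nth (X m) n - l1_nth (X k) n))
              \<longlonglongrightarrow> (\<Sum>n<K. norm (l1_nth (X m) n - y n))"
        by (intro tendsto_intros y)
      have "(\<Sum>n<K. norm (l1_nth (X m) n - l1_nth (X k) n)) \<le> e" if k: "k \<ge> M" for k
      proof -
        have "(\<Sum>n<K. norm (l1_nth (X m - X k) n)) \<le> norm (X m - X k)"
          unfolding norm_l1_sum.rep_eq by (intro sum_le_suminf summable_l1_nth) auto
        also have "\<dots> \<le> e" using M[OF m k] by (simp add: dist_norm)
        finally show ?thesis by (simp add: minus_l1_sum.rep_eq)
      qed
      then show "\<exists>N. \<forall>k\<ge>N. (\<Sum>n<K. norm (l1_nth (X m) n - l1_nth (X k) n)) \<le> e" by blast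
    qed
    then show ?thesis by blast
  qed
  have summ: "summable (\<lambda>n. norm (l1_nth (X m) n - y n))"
    if "\<And>K. (\<Sum>n<K. norm (l1_nth (X m) n - y n)) \<le> e" for m e
    by (rule summableI_nonneg_bounded[OF norm_ge_zero that])
  obtain M where M: "\<And>K. (\<Sum>n<K. norm (l1_nth (X M) n - y n)) \<le> 1"
    using bound[of 1] by auto
  have "norm (y n) \<le> norm (l1_nth (X M) n - y n) + norm (l1_nth (X M) n)" for n
    by (metis add.commute norm_minus_commute norm_triangle_sub)
  then have "summable (\<lambda>n. norm (y n))"
    by (intro summable_comparison_test'[OF summable_add[OF summ[OF M] summable_l1_nth[of "X M"]]])
       auto
  then obtain z where z: "l1_nth z = y"
    using Abs_l1_sum_inverse by blast
  have "X \<longlonglongrightarrow> z"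
  proof (rule metric_LIMSEQ_I)
    fix e :: real assume "e > 0"
    then obtain M where M: "\<And>m K. m \<ge> M \<Longrightarrow> (\<Sum>n<K. norm (l1_nth (X m) n - y n)) \<le> e / 2"
      using bound[of "e / 2"] by auto
    have "dist (X m) z < e" if "m \<ge> M" for m
    proof -
      have "dist (X m) z \<le> e / 2"
        unfolding dist_norm norm_l1_sum.rep_eq minus_l1_sum.rep_eq z
        by (rule suminf_le_const[OF summ[OF M[OF that]] M[OF that]])
      then show ?thesis using \<open>e > 0\<close> by simp
    qed
    then show "\<exists>M. \<forall>m\<ge>M. dist (X m) z < e" by blast
  qed
  then show "convergent X" by (auto simp: convergent_def)
qed

type_synonym l1 = "real l1_sum"

lift_definition l1_basis :: "nat \<Rightarrow> l1" is "\<lambda>n k. if k = n then 1 else 0"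
  by (auto intro: summable_finite[of "{_}"])


section \<open>The integer grid of \<open>\<ell>\<^sub>1\<close>\<close>

typedef l1_grid = "{x :: l1. \<exists>(N :: nat) (a :: nat \<Rightarrow> int). x = (\<Sum>n<N. of_int (a n) *\<^sub>R l1_basis n)}"
  morphisms l1_of_grid Abs_l1_grid
  by (rule exI[of _ 0]) (auto intro: exI[of _ 0])

setup_lifting type_definition_l1_grid

instantiation l1_grid :: "{metric_space, zero}"
begin

lift_definition zero_l1_grid :: l1_grid is 0
  by (auto intro: exI[of _ 0])

lift_definition dist_l1_grid :: "l1_grid \<Rightarrow> l1_grid \<Rightarrow> real" is dist .

definition uniformity_l1_grid :: "(l1_grid \<times> l1_grid) filter"
  where "uniformity_l1_grid = (INF e\<in>{0<..}. principal {(x, y). dist x y < e})"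

definition open_l1_grid :: "l1_grid set \<Rightarrow> bool"
  where "open_l1_grid U \<longleftrightarrow> (\<forall>x\<in>U. \<forall>\<^sub>F (x', y) in uniformity. x' = x \<longrightarrow> y \<in> U)"

instance
proof
  fix x y z :: l1_grid
  show "dist x y = 0 \<longleftrightarrow> x = y" by transfer simp
  show "dist x y \<le> dist x z + dist y z" by transfer (rule dist_triangle2)
qed (simp_all add: uniformity_l1_grid_def open_l1_grid_def)

end


section \<open>Lipschitz functions vanishing at the base point\<close>

text \<open>The class constraint \<open>zero\<close> only serves to provide the base point \<open>0\<close>.\<close>

typedef (overloaded) 'a lip0 =
  "{f :: 'a::{metric_space, zero} \<Rightarrow> real. f 0 = 0 \<and> (\<exists>C. C-lipschitz_on UNIV f)}"
  morphisms lip0_apply Abs_lip0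
  by (rule exI[of _ "\<lambda>_. 0"]) (auto intro: lipschitz_intros)

setup_lifting type_definition_lip0

lemma lipschitz_on_Inf:
  fixes f :: "'a::metric_space \<Rightarrow> real"
  assumes "\<exists>C. C-lipschitz_on UNIV f"
  shows "(Inf {C. C-lipschitz_on UNIV f})-lipschitz_on UNIV f"
proof (rule lipschitz_onI)
  have ne: "{C. C-lipschitz_on UNIV f} \<noteq> {}" using assms by auto
  show "0 \<le> Inf {C. C-lipschitz_on UNIV f}"
    by (rule cInf_greatest[OF ne]) (auto dest: lipschitz_on_nonneg)
  fix x y :: 'a
  show "dist (f x) (f y) \<le> Inf {C. C-lipschitz_on UNIV f} * dist x y"
  proof (cases "x = y")
    case False
    have "dist (f x) (f y) / dist x y \<le> Inf {C. C-lipschitz_on UNIV f}"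
      using False
      by (intro cInf_greatest[OF ne]) (auto simp: divide_simps dest: lipschitz_onD)
    then show ?thesis using False by (simp add: divide_simps)
  qed simp
qed

lemma Inf_lipschitz_le:
  fixes f :: "'a::metric_space \<Rightarrow> real"
  assumes "C-lipschitz_on UNIV f"
  shows "Inf {C. C-lipschitz_on UNIV f} \<le> C"
  by (rule cInf_lower) (use assms in \<open>auto intro!: bdd_belowI[of _ 0] dest: lipschitz_on_nonneg\<close>)

instantiation lip0 :: ("{metric_space, zero}") real_normed_vector
begin

lift_definition zero_lip0 :: "'a lip0" is "\<lambda>_. 0" by (auto intro: lipschitz_intros)

lift_definition plus_lip0 :: "'a lip0 \<Rightarrow> 'a lip0 \<Rightarrow> 'a lip0" is "\<lambda>f g x. f x + g x"
  by (auto intro: lipschitz_intros)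

lift_definition uminus_lip0 :: "'a lip0 \<Rightarrow> 'a lip0" is "\<lambda>f x. - f x"
  by (auto intro: lipschitz_intros)

lift_definition minus_lip0 :: "'a lip0 \<Rightarrow> 'a lip0 \<Rightarrow> 'a lip0" is "\<lambda>f g x. f x - g x"
  by (auto intro: lipschitz_intros)

lift_definition scaleR_lip0 :: "real \<Rightarrow> 'a lip0 \<Rightarrow> 'a lip0" is "\<lambda>c f x. c * f x"
  by (auto intro: lipschitz_on_cmult_real)

lift_definition norm_lip0 :: "'a lip0 \<Rightarrow> real" is "\<lambda>f. Inf {C. C-lipschitz_on UNIV f}" .

definition dist_lip0 :: "'a lip0 \<Rightarrow> 'a lip0 \<Rightarrow> real"
  where "dist_lip0 f g = norm (f - g)"

definition sgn_lip0 :: "'a lip0 \<Rightarrow> 'a lip0"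
  where "sgn_lip0 f = inverse (norm f) *\<^sub>R f"

definition uniformity_lip0 :: "('a lip0 \<times> 'a lip0) filter"
  where "uniformity_lip0 = (INF e\<in>{0<..}. principal {(f, g). dist f g < e})"

definition open_lip0 :: "'a lip0 set \<Rightarrow> bool"
  where "open_lip0 U \<longleftrightarrow> (\<forall>f\<in>U. \<forall>\<^sub>F (f', g) in uniformity. f' = f \<longrightarrow> g \<in> U)"

instance
proof
  fix f g :: "'a lip0" and a :: real
  have norm_nonneg: "0 \<le> norm h" for h :: "'a lip0"
    by transfer (auto dest: lipschitz_on_Inf[THEN lipschitz_on_nonneg, OF exI])
  have scale_le: "norm (c *\<^sub>R h) \<le> \<bar>c\<bar> * norm h" for c and h :: "'a lip0"
    by transfer (auto intro!: Inf_lipschitz_le lipschitz_on_cmult_real lipschitz_on_Inf)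
  show "norm f = 0 \<longleftrightarrow> f = 0"
  proof transfer
    fix f :: "'a \<Rightarrow> real"
    assume f: "f 0 = 0 \<and> (\<exists>C. C-lipschitz_on UNIV f)"
    show "Inf {C. C-lipschitz_on UNIV f} = 0 \<longleftrightarrow> f = (\<lambda>_. 0)"
    proof
      assume "Inf {C. C-lipschitz_on UNIV f} = 0"
      then have L: "0-lipschitz_on UNIV f" using lipschitz_on_Inf[of f] f by simp
      then have "f x = f 0" for x using lipschitz_onD[OF L, of x 0] by simp
      then show "f = (\<lambda>_. 0)" using f by auto
    next
      assume [simp]: "f = (\<lambda>_. 0)"
      have L: "0-lipschitz_on UNIV f" by (auto intro: lipschitz_intros)
      show "Inf {C. C-lipschitz_on UNIV f} = 0"
        using Inf_lipschitz_le[OF L] lipschitz_on_nonneg[OF lipschitz_on_Inf[of f]] L by force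
    qed
  qed
  show "norm (f + g) \<le> norm f + norm g"
    by transfer (auto intro!: Inf_lipschitz_le lipschitz_on_add lipschitz_on_Inf)
  show "norm (a *\<^sub>R f) = \<bar>a\<bar> * norm f"
  proof (cases "a = 0")
    case True
    then show ?thesis using scale_le[of a f] norm_nonneg by (simp add: antisym)
  next
    case False
    have "inverse a *\<^sub>R (a *\<^sub>R f) = f" using False by transfer (simp add: fun_eq_iff)
    then have "norm f \<le> \<bar>inverse a\<bar> * norm (a *\<^sub>R f)" by (metis scale_le)
    then have "\<bar>a\<bar> * norm f \<le> norm (a *\<^sub>R f)"
      using False by (simp add: abs_inverse field_simps)
    then show ?thesis using scale_le[of a f] by simp
  qed
qed (simp_all add: dist_lip0_def sgn_lip0_def uniformity_lip0_def open_lip0_def,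
     (transfer, simp add: fun_eq_iff algebra_simps)+)

end

lemma lip0_apply_dist_le:
  fixes f :: "'a::{metric_space, zero} lip0"
  shows "\<bar>lip0_apply f x - lip0_apply f y\<bar> \<le> norm f * dist x y"
proof transfer
  fix f :: "'a \<Rightarrow> real" and x y
  assume "f 0 = 0 \<and> (\<exists>C. C-lipschitz_on UNIV f)"
  then show "\<bar>f x - f y\<bar> \<le> Inf {C. C-lipschitz_on UNIV f} * dist x y"
    using lipschitz_onD[OF lipschitz_on_Inf[of f], of x y] by (auto simp: dist_real_def)
qed

lemma lip0_apply_zero: "lip0_apply f 0 = 0"
  by transfer simp


section \<open>Lipschitz-free spaces\<close>

lift_definition lip_delta :: "'a::{metric_space, zero} \<Rightarrow> 'a lip0 \<Rightarrow>\<^sub>L real"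
  is "\<lambda>x f. lip0_apply f x"
proof
  fix x :: 'a and f g :: "'a lip0" and c :: real
  show "lip0_apply (f + g) x = lip0_apply f x + lip0_apply g x" by transfer simp
  show "lip0_apply (c *\<^sub>R f) x = c *\<^sub>R lip0_apply f x" by transfer simp
  show "\<exists>K. \<forall>f. norm (lip0_apply f x) \<le> norm f * K"
    using lip0_apply_dist_le[of _ x 0] by (auto simp: lip0_apply_zero)
qed

typedef (overloaded) 'a free_space =
  "closure (span (range (lip_delta :: 'a::{metric_space, zero} \<Rightarrow> 'a lip0 \<Rightarrow>\<^sub>L real)))"
  morphisms functional_of_free Abs_free_space
  using closure_subset span_zero by blast

setup_lifting type_definition_free_space

lemma subspace_closure:
  fixes S :: "'a::real_normed_vector set"
  assumes "subspace S"
  shows "subspace (closure S)"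
proof (rule subspaceI)
  show "0 \<in> closure S"
    using subspace_0[OF assms] closure_subset by blast
next
  fix x y assume "x \<in> closure S" "y \<in> closure S"
  then obtain f g where "\<forall>n. f n \<in> S" "f \<longlonglongrightarrow> x" "\<forall>n. g n \<in> S" "g \<longlonglongrightarrow> y"
    unfolding closure_sequential by blast
  then show "x + y \<in> closure S"
    unfolding closure_sequential
    by (intro exI[of _ "\<lambda>n. f n + g n"]) (auto intro: tendsto_add subspace_add[OF assms])
next
  fix c :: real and x assume "x \<in> closure S"
  then obtain f where "\<forall>n. f n \<in> S" "f \<longlonglongrightarrow> x"
    unfolding closure_sequential by blast
  then show "c *\<^sub>R x \<in> closure S"
    unfolding closure_sequential
    by (intro exI[of _ "\<lambda>n. c *\<^sub>R f n"])
       (auto intro: tendsto_scaleR subspace_scale[OF assms])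
qed

lemma subspace_free: "subspace (closure (span (range lip_delta)))"
  by (intro subspace_closure subspace_span)

instantiation free_space :: ("{metric_space, zero}") real_normed_vector
begin

lift_definition zero_free_space :: "'a free_space" is 0
  by (rule subspace_0[OF subspace_free])

lift_definition plus_free_space :: "'a free_space \<Rightarrow> 'a free_space \<Rightarrow> 'a free_space" is "(+)"
  by (rule subspace_add[OF subspace_free])

lift_definition uminus_free_space :: "'a free_space \<Rightarrow> 'a free_space" is uminus
  by (rule subspace_neg[OF subspace_free])

lift_definition minus_free_space :: "'a free_space \<Rightarrow> 'a free_space \<Rightarrow> 'a free_space" is "(-)"
  by (rule subspace_diff[OF subspace_free])

lift_definition scaleR_free_space :: "real \<Rightarrow> 'a free_space \<Rightarrow> 'a free_space" is scaleR
  by (rule subspace_scale[OF subspace_free])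

lift_definition norm_free_space :: "'a free_space \<Rightarrow> real" is norm .

definition dist_free_space :: "'a free_space \<Rightarrow> 'a free_space \<Rightarrow> real"
  where "dist_free_space x y = norm (x - y)"

definition sgn_free_space :: "'a free_space \<Rightarrow> 'a free_space"
  where "sgn_free_space x = inverse (norm x) *\<^sub>R x"

definition uniformity_free_space :: "('a free_space \<times> 'a free_space) filter"
  where "uniformity_free_space = (INF e\<in>{0<..}. principal {(x, y). dist x y < e})"

definition open_free_space :: "'a free_space set \<Rightarrow> bool"
  where "open_free_space U \<longleftrightarrow> (\<forall>x\<in>U. \<forall>\<^sub>F (x', y) in uniformity. x' = x \<longrightarrow> y \<in> U)"

instance
proof
  fix x y :: "'a free_space"
  show "norm (x + y) \<le> norm x + norm y" by transfer (rule norm_triangle_ineq)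
qed (simp_all add: dist_free_space_def sgn_free_space_def uniformity_free_space_def
       open_free_space_def, (transfer, simp add: algebra_simps)+)

end

instance free_space :: ("{metric_space, zero}") banach
proof
  fix X :: "nat \<Rightarrow> 'a free_space"
  assume "Cauchy X"
  have d: "dist (functional_of_free x) (functional_of_free y) = dist x y" for x y :: "'a free_space"
    by (simp add: dist_norm norm_free_space.rep_eq minus_free_space.rep_eq)
  have "Cauchy (\<lambda>n. functional_of_free (X n))"
    using \<open>Cauchy X\<close> by (simp add: Cauchy_def d)
  then obtain l where l: "(\<lambda>n. functional_of_free (X n)) \<longlonglongrightarrow> l"
    unfolding Cauchy_convergent_iff convergent_def by blast
  have "l \<in> closure (span (range lip_delta))"
    by (rule closed_sequentially[OF closed_closure _ l]) (use functional_of_free in blast)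
  then obtain z where z: "functional_of_free z = l"
    using Abs_free_space_inverse by blast
  have "X \<longlonglongrightarrow> z"
    using l by (simp add: z[symmetric] lim_sequentially d)
  then show "convergent X" by (auto simp: convergent_def)
qed


end

theory Submission
  imports Defs
begin

text \<open>
  Splitting \<open>\<nat>\<close> into infinitely many infinite blocks gives isometric embeddings \<open>s\<^sub>n\<close> of the grid onto
  the points supported in the \<open>n\<close>-th block and block projections \<open>\<pi>\<^sub>n\<close>, and
  \<open>\<Sum>\<^sub>n d (\<pi>\<^sub>n x, \<pi>\<^sub>n y) \<le> d (x, y)\<close> because the metric is an \<open>\<ell>\<^sub>1\<close>-metric.  By duality with Lipschitz
  functions this makes \<open>P \<mu> = (\<pi>\<^sub>n\<^sub>* \<mu>)\<^sub>n\<close> a bounded operator from the free space \<open>X\<close> to \<open>\<ell>\<^sub>1(X)\<close>, and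
  \<open>J u = \<Sum>\<^sub>n s\<^sub>n\<^sub>* u\<^sub>n\<close> is a bounded right inverse.  So \<open>\<ell>\<^sub>1(X)\<close> is complemented in \<open>X\<close>, and
  Pelczynski's decomposition method yields \<open>X \<cong> \<ell>\<^sub>1(X)\<close>.
\<close>

section \<open>Operators into and out of countable \<open>\<ell>\<^sub>1\<close>-sums\<close>

lemma l1_sum_eqI: "(\<And>n. l1_nth x n = l1_nth y n) \<Longrightarrow> x = y"
  by (metis ext l1_nth_inject)

lemma bounded_linear_l1_nth: "bounded_linear (\<lambda>x. l1_nth x n)"
  by (rule bounded_linear_intro[where K = 1])
     (auto simp: plus_l1_sum.rep_eq scaleR_l1_sum.rep_eq norm_l1_nth_le)

lemma sum_norm_l1_nth_le: "finite F \<Longrightarrow> (\<Sum>n\<in>F. norm (l1_nth x n)) \<le> norm x"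
  unfolding norm_l1_sum.rep_eq by (intro sum_le_suminf summable_l1_nth) auto

text \<open>The uniform bound on partial sums serves twice: it makes each sequence of values
  absolutely summable, hence an element of the sum, and in the limit it bounds the operator by
  \<open>C\<close>.\<close>

lemma bounded_linear_into_l1_sum:
  fixes f :: "nat \<Rightarrow> 'a::real_normed_vector \<Rightarrow> 'b::real_normed_vector"
  assumes lin: "\<And>n. linear (f n)"
    and bound: "\<And>x N. (\<Sum>n<N. norm (f n x)) \<le> C * norm x"
  obtains F where "bounded_linear F" "\<And>x n. l1_nth (F x) n = f n x"
proof
  define F where "F x = Abs_l1_sum (\<lambda>n. f n x)" for x
  have summ: "summable (\<lambda>n. norm (f n x))" for x
    by (rule summableI_nonneg_bounded[OF norm_ge_zero bound])
  show nth: "l1_nth (F x) n = f n x" for x n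
    unfolding F_def by (subst Abs_l1_sum_inverse) (auto simp: summ)
  show "bounded_linear F"
  proof (rule bounded_linear_intro[where K = C])
    show "F (x + y) = F x + F y" for x y
      by (rule l1_sum_eqI) (simp add: nth plus_l1_sum.rep_eq linear_add[OF lin])
    show "F (r *\<^sub>R x) = r *\<^sub>R F x" for r x
      by (rule l1_sum_eqI) (simp add: nth scaleR_l1_sum.rep_eq linear_scale[OF lin])
    show "norm (F x) \<le> norm x * C" for x
      unfolding norm_l1_sum.rep_eq nth
      by (rule suminf_le_const[OF summ]) (use bound in \<open>simp add: mult.commute\<close>)
  qed
qed

lemma bounded_linear_l1_map:
  assumes "bounded_linear A"
  obtains F where "bounded_linear F" "\<And>u n. l1_nth (F u) n = A (l1_nth u n)"
proof (rule bounded_linear_into_l1_sum)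
  show "linear (\<lambda>u. A (l1_nth u n))" for n
    by (intro bounded_linear.linear bounded_linear_compose[OF assms] bounded_linear_l1_nth)
  show "(\<Sum>n<N. norm (A (l1_nth u n))) \<le> onorm A * norm u" for u N
  proof -
    have "(\<Sum>n<N. norm (A (l1_nth u n))) \<le> (\<Sum>n<N. onorm A * norm (l1_nth u n))"
      by (intro sum_mono onorm assms)
    also have "\<dots> \<le> onorm A * norm u"
      by (simp add: sum_distrib_left[symmetric] mult_left_mono sum_norm_l1_nth_le
          onorm_pos_le assms)
    finally show ?thesis .
  qed
qed (rule that)

text \<open>Tail, right shift and embedding as entry 0 are, with the entrywise maps, the building
  blocks of the isomorphism and its inverse in the decomposition argument.\<close>

lemma bounded_linear_l1_tail:
  obtains F :: "'a::real_normed_vector l1_sum \<Rightarrow> 'a l1_sum"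
  where "bounded_linear F" "\<And>u n. l1_nth (F u) n = l1_nth u (Suc n)"
proof (rule bounded_linear_into_l1_sum)
  show "linear (\<lambda>u::'a l1_sum. l1_nth u (Suc n))" for n
    by (intro bounded_linear.linear bounded_linear_l1_nth)
  show "(\<Sum>n<N. norm (l1_nth u (Suc n))) \<le> 1 * norm u" for u :: "'a l1_sum" and N
    using sum_norm_l1_nth_le[of "Suc ` {..<N}" u] by (simp add: sum.reindex)
qed (rule that)

lemma bounded_linear_l1_shift:
  obtains F :: "'a::real_normed_vector l1_sum \<Rightarrow> 'a l1_sum"
  where "bounded_linear F" "\<And>u n. l1_nth (F u) n = (case n of 0 \<Rightarrow> 0 | Suc k \<Rightarrow> l1_nth u k)"
proof (rule bounded_linear_into_l1_sum)
  show "linear (\<lambda>u::'a l1_sum. case n of 0 \<Rightarrow> 0 | Suc k \<Rightarrow> l1_nth u k)" for n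
    by (cases n) (auto intro: bounded_linear.linear bounded_linear_l1_nth bounded_linear_zero)
  show "(\<Sum>n<N. norm (case n of 0 \<Rightarrow> 0 | Suc k \<Rightarrow> l1_nth u k)) \<le> 1 * norm u"
    for u :: "'a l1_sum" and N
    by (cases N) (simp_all add: sum.lessThan_Suc_shift sum_norm_l1_nth_le del: sum.lessThan_Suc)
qed (rule that)

lemma bounded_linear_l1_single:
  obtains F :: "'a::real_normed_vector \<Rightarrow> 'a l1_sum"
  where "bounded_linear F" "\<And>x n. l1_nth (F x) n = (case n of 0 \<Rightarrow> x | Suc k \<Rightarrow> 0)"
proof (rule bounded_linear_into_l1_sum)
  show "linear (\<lambda>x::'a. case n of 0 \<Rightarrow> x | Suc k \<Rightarrow> 0)" for n
    by (cases n) (auto intro: bounded_linear.linear bounded_linear_ident bounded_linear_zero)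
  show "(\<Sum>n<N. norm (case n of 0 \<Rightarrow> x | Suc k \<Rightarrow> 0)) \<le> 1 * norm x" for x :: 'a and N
    by (cases N) (simp_all add: sum.lessThan_Suc_shift del: sum.lessThan_Suc)
qed (rule that)

text \<open>A common bound \<open>C\<close> makes the series absolutely convergent, and completeness
  of the codomain gives its sum: uniformly bounded families extend to the whole sum.\<close>

lemma bounded_linear_from_l1_sum:
  fixes g :: "nat \<Rightarrow> 'a::real_normed_vector \<Rightarrow> 'b::banach"
  assumes lin: "\<And>n. linear (g n)"
    and bound: "\<And>n x. norm (g n x) \<le> C * norm x"
  shows "summable (\<lambda>n. g n (l1_nth u n))"
    and "bounded_linear (\<lambda>u. \<Sum>n. g n (l1_nth u n))"
proof -
  have abs: "summable (\<lambda>n. norm (g n (l1_nth u n)))" for u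
    by (rule summable_comparison_test'[OF summable_mult[OF summable_l1_nth[of u], of C], where N = 0])
       (simp add: bound)
  show summ: "summable (\<lambda>n. g n (l1_nth u n))" for u
    by (rule summable_norm_cancel[OF abs])
  show "bounded_linear (\<lambda>u. \<Sum>n. g n (l1_nth u n))"
  proof (rule bounded_linear_intro[where K = C])
    show "(\<Sum>n. g n (l1_nth (u + v) n)) = (\<Sum>n. g n (l1_nth u n)) + (\<Sum>n. g n (l1_nth v n))" for u v
      by (simp add: plus_l1_sum.rep_eq linear_add[OF lin] suminf_add[OF summ summ])
    show "(\<Sum>n. g n (l1_nth (r *\<^sub>R u) n)) = r *\<^sub>R (\<Sum>n. g n (l1_nth u n))" for r u
      by (simp add: scaleR_l1_sum.rep_eq linear_scale[OF lin] suminf_scaleR_right[OF summ])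
    show "norm (\<Sum>n. g n (l1_nth u n)) \<le> norm u * C" for u
    proof -
      have "norm (\<Sum>n. g n (l1_nth u n)) \<le> (\<Sum>n. norm (g n (l1_nth u n)))"
        by (rule summable_norm[OF abs])
      also have "\<dots> \<le> (\<Sum>n. C * norm (l1_nth u n))"
        by (intro suminf_le bound abs summable_mult summable_l1_nth)
      finally show ?thesis
        by (simp add: suminf_mult[OF summable_l1_nth] norm_l1_sum.rep_eq mult.commute)
    qed
  qed
qed

text \<open>
  With \<open>R = J \<circ> P\<close> and \<open>W = ker P\<close>, the chain
  \<open>X \<cong> W \<oplus> \<ell>\<^sub>1(X) \<cong> W \<oplus> \<ell>\<^sub>1(\<ell>\<^sub>1(X)) \<oplus> \<ell>\<^sub>1(W) \<cong> \<ell>\<^sub>1(\<ell>\<^sub>1(X)) \<oplus> \<ell>\<^sub>1(W) \<cong> \<ell>\<^sub>1(X)\<close> composes to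
  \<open>x \<mapsto> (R u\<^sub>0 + (1 - R) x, R u\<^sub>1 + (1 - R) u\<^sub>0, R u\<^sub>2 + (1 - R) u\<^sub>1, \<dots>)\<close> where \<open>u = P x\<close>.
\<close>
lemma pelczynski_decomposition:
  fixes P :: "'a::real_normed_vector \<Rightarrow> 'a l1_sum" and J :: "'a l1_sum \<Rightarrow> 'a"
  assumes P: "bounded_linear P" and J: "bounded_linear J" and PJ: "\<And>u. P (J u) = u"
  shows "\<exists>T :: 'a \<Rightarrow> 'a l1_sum. bij T \<and> bounded_linear T \<and> bounded_linear (inv T)"
proof -
  define R where "R x = J (P x)" for x
  have R: "bounded_linear R"
    unfolding R_def by (rule bounded_linear_compose[OF J P])
  define R' where "R' x = x - R x" for x
  have R': "bounded_linear R'"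
    unfolding R'_def by (intro bounded_linear_sub bounded_linear_ident R)
  have RR: "R (R x) = R x" for x by (simp add: R_def PJ)
  note add = linear_add[OF bounded_linear.linear]
    and diff = linear_diff[OF bounded_linear.linear]
    and lin0 = linear_0[OF bounded_linear.linear]
  have RR': "R (R' x) = 0" and R'R: "R' (R x) = 0" and R'R': "R' (R' x) = R' x"
    and PR': "P (R' x) = 0" and RpR': "R x + R' x = x" for x
    by (simp_all add: R'_def diff[OF R] diff[OF P] RR R_def PJ lin0[OF J])
  obtain LR where LR: "bounded_linear LR" "\<And>u n. l1_nth (LR u) n = R (l1_nth u n)"
    using bounded_linear_l1_map[OF R] by blast
  obtain LR' where LR': "bounded_linear LR'" "\<And>u n. l1_nth (LR' u) n = R' (l1_nth u n)"
    using bounded_linear_l1_map[OF R'] by blast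
  obtain tl where tl: "bounded_linear tl" "\<And>u n. l1_nth (tl u :: 'a l1_sum) n = l1_nth u (Suc n)"
    using bounded_linear_l1_tail by blast
  obtain sh where sh: "bounded_linear sh"
    "\<And>u n. l1_nth (sh u :: 'a l1_sum) n = (case n of 0 \<Rightarrow> 0 | Suc k \<Rightarrow> l1_nth u k)"
    using bounded_linear_l1_shift by blast
  obtain si where si: "bounded_linear si"
    "\<And>x n. l1_nth (si x :: 'a l1_sum) n = (case n of 0 \<Rightarrow> x | Suc k \<Rightarrow> 0)"
    using bounded_linear_l1_single by blast
  define T where "T x = LR (P x) + (si (R' x) + sh (LR' (P x)))" for x
  \<comment> \<open>\<open>U\<close> undoes the shift in \<open>T\<close>: entry \<open>n\<close> of
    \<open>T x\<close> still holds the \<open>R\<close>-part of entry \<open>n\<close> of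
    \<open>P x\<close>, while its \<open>R'\<close>-part sits in entry \<open>n + 1\<close>. Hence
    \<open>U (T x) = P x\<close>.\<close>
  define U where "U v = LR v + tl (LR' v)" for v
  \<comment> \<open>The inverse of \<open>T\<close>: \<open>J\<close> applied to the recovered
    \<open>P x\<close> gives \<open>R x\<close>, and entry 0 of \<open>T x\<close> carries the
    missing \<open>R' x\<close>.\<close>
  define S where "S v = J (U v) + R' (l1_nth v 0)" for v
  have T: "bounded_linear T"
    unfolding T_def
    by (intro bounded_linear_add bounded_linear_compose[OF LR(1) P]
        bounded_linear_compose[OF si(1) R'] bounded_linear_compose[OF sh(1)]
        bounded_linear_compose[OF LR'(1) P])
  have U: "bounded_linear U"
    unfolding U_def
    by (intro bounded_linear_add LR(1) bounded_linear_compose[OF tl(1) LR'(1)])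
  have S: "bounded_linear S"
    unfolding S_def
    by (intro bounded_linear_add bounded_linear_compose[OF J U]
        bounded_linear_compose[OF R'] bounded_linear_l1_nth)
  have T_nth: "l1_nth (T x) n =
      R (l1_nth (P x) n) + R' (case n of 0 \<Rightarrow> x | Suc k \<Rightarrow> l1_nth (P x) k)" for x n
    by (simp add: T_def plus_l1_sum.rep_eq LR LR' si sh split: nat.split)
  have U_nth: "l1_nth (U v) n = R (l1_nth v n) + R' (l1_nth v (Suc n))" for v n
    by (simp add: U_def plus_l1_sum.rep_eq LR LR' tl)
  have "U (T x) = P x" for x
    by (rule l1_sum_eqI)
       (simp add: U_nth T_nth add[OF R] add[OF R'] RR RR' R'R R'R' RpR')
  then have ST: "S (T x) = x" for x
    by (simp add: S_def T_nth add[OF R'] R'R R'R') (simp add: R'_def R_def)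
  have "P (S v) = U v" for v
    by (simp add: S_def add[OF P] PJ PR')
  \<comment> \<open>By the previous fact \<open>R (S v) = J (U v)\<close>, so subtracting it from
    \<open>S v\<close> leaves only the second summand.\<close>
  moreover have "R' (S v) = R' (l1_nth v 0)" for v
    using R'R[of "S v"] calculation[of v]
    by (simp add: R'_def R_def S_def)
  ultimately have TS: "T (S v) = v" for v
    by (intro l1_sum_eqI)
       (simp add: T_nth U_nth add[OF R] add[OF R'] RR RR' R'R R'R' RpR' split: nat.split)
  have "bij T" by (rule o_bij[of S]) (auto simp: ST TS fun_eq_iff)
  moreover have "inv T = S" by (rule inv_equality) (simp_all add: ST TS)
  ultimately show ?thesis using T S by auto
qed


section \<open>Functoriality of Lipschitz-free spaces\<close>

definition lip_pull :: "('a::{metric_space, zero} \<Rightarrow> 'b::{metric_space, zero}) \<Rightarrow> 'b lip0 \<Rightarrow> 'a lip0"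
  where "lip_pull f g = Abs_lip0 (\<lambda>x. lip0_apply g (f x))"

text \<open>Push-forward, that is, the adjoint of \<open>lip_pull f\<close> restricted to the free
  space. It is meaningful when \<open>f\<close> is Lipschitz and preserves base points; otherwise
  \<open>Blinfun\<close> and \<open>Abs_free_space\<close> may give arbitrary values.\<close>

definition free_map ::
  "('a::{metric_space, zero} \<Rightarrow> 'b::{metric_space, zero}) \<Rightarrow> 'a free_space \<Rightarrow> 'b free_space"
  where "free_map f \<mu> = Abs_free_space (functional_of_free \<mu> o\<^sub>L Blinfun (lip_pull f))"

lemma lip0_eqI: "(\<And>x. lip0_apply f x = lip0_apply g x) \<Longrightarrow> f = g"
  by (metis ext lip0_apply_inject)

lemma norm_lip0_le: "C-lipschitz_on UNIV (lip0_apply f) \<Longrightarrow> norm f \<le> C"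
  by (simp add: norm_lip0.rep_eq Inf_lipschitz_le)

lemma lipschitz_lip0: "(norm f)-lipschitz_on UNIV (lip0_apply f)"
  by (rule lipschitz_onI) (simp_all add: dist_real_def lip0_apply_dist_le)

context
  fixes f :: "'a::{metric_space, zero} \<Rightarrow> 'b::{metric_space, zero}" and C :: real
  assumes lip: "C-lipschitz_on UNIV f" and zero: "f 0 = 0"
begin

lemma lipschitz_lip0_comp: "(norm g * C)-lipschitz_on UNIV (\<lambda>x. lip0_apply g (f x))"
  using lipschitz_on_compose2[OF lip lipschitz_on_subset[OF lipschitz_lip0, of _ g]] by simp

lemma lip_pull_apply: "lip0_apply (lip_pull f g) x = lip0_apply g (f x)"
  unfolding lip_pull_def
  by (subst Abs_lip0_inverse) (use lipschitz_lip0_comp in \<open>auto simp: zero lip0_apply_zero\<close>)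

lemma norm_lip_pull_le: "norm (lip_pull f g) \<le> norm g * C"
  by (rule norm_lip0_le) (use lipschitz_lip0_comp in \<open>simp add: lip_pull_apply[abs_def]\<close>)

lemma bounded_linear_lip_pull: "bounded_linear (lip_pull f)"
  by (rule bounded_linear_intro[OF _ _ norm_lip_pull_le])
     (auto intro!: lip0_eqI simp: lip_pull_apply plus_lip0.rep_eq scaleR_lip0.rep_eq)

text \<open>The adjoint sends \<open>lip_delta x\<close> to \<open>lip_delta (f x)\<close>, so by
  linearity and continuity it preserves the closed span; this justifies the use of
  \<open>Abs_free_space\<close>.\<close>

lemma functional_of_free_map_eq:
  "functional_of_free (free_map f \<mu>) = functional_of_free \<mu> o\<^sub>L Blinfun (lip_pull f)"
proof -
  define A where "A \<phi> = \<phi> o\<^sub>L Blinfun (lip_pull f)" for \<phi> :: "'a lip0 \<Rightarrow>\<^sub>L real"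
  have A: "bounded_linear A"
    unfolding A_def by (rule bounded_bilinear.bounded_linear_left[OF bounded_bilinear_blinfun_compose])
  have "A (lip_delta x) = lip_delta (f x)" for x
    by (rule blinfun_eqI)
       (simp add: A_def lip_delta.rep_eq bounded_linear_Blinfun_apply[OF bounded_linear_lip_pull]
         lip_pull_apply)
  then have "A ` range lip_delta \<subseteq> range lip_delta" by auto
  then have "A ` span (range lip_delta) \<subseteq> span (range lip_delta)"
    by (simp add: linear_span_image[OF bounded_linear.linear[OF A], symmetric] span_mono)
  moreover have "A ` closure (span (range lip_delta)) \<subseteq> closure (A ` span (range lip_delta))"
    by (rule closure_bounded_linear_image_subset[OF A])
  ultimately have "A ` closure (span (range lip_delta)) \<subseteq> closure (span (range lip_delta))"
    using closure_mono by blast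
  then have "A (functional_of_free \<mu>) \<in> closure (span (range lip_delta))"
    using functional_of_free by blast
  then show ?thesis
    unfolding free_map_def A_def by (rule Abs_free_space_inverse)
qed

lemma functional_of_free_map:
  "functional_of_free (free_map f \<mu>) g = functional_of_free \<mu> (lip_pull f g)"
  by (simp add: functional_of_free_map_eq bounded_linear_Blinfun_apply[OF bounded_linear_lip_pull])

lemma linear_free_map: "linear (free_map f)"
proof
  show "free_map f (\<mu> + \<nu>) = free_map f \<mu> + free_map f \<nu>" for \<mu> \<nu>
    by (subst functional_of_free_inject[symmetric], rule blinfun_eqI)
       (simp add: functional_of_free_map plus_free_space.rep_eq blinfun.add_left)
  show "free_map f (r *\<^sub>R \<mu>) = r *\<^sub>R free_map f \<mu>" for r \<mu>
    by (subst functional_of_free_inject[symmetric], rule blinfun_eqI)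
       (simp add: functional_of_free_map scaleR_free_space.rep_eq blinfun.scaleR_left)
qed

lemma norm_free_map_le: "norm (free_map f \<mu>) \<le> C * norm \<mu>"
  unfolding norm_free_space.rep_eq
proof (rule norm_blinfun_bound)
  have "0 \<le> C" using lip by (rule lipschitz_on_nonneg)
  then show "0 \<le> C * norm (functional_of_free \<mu>)" by simp
  show "norm (functional_of_free (free_map f \<mu>) g) \<le> C * norm (functional_of_free \<mu>) * norm g" for g
  proof -
    have "norm (functional_of_free \<mu> (lip_pull f g)) \<le> norm (functional_of_free \<mu>) * norm (lip_pull f g)"
      by (rule norm_blinfun)
    also have "\<dots> \<le> norm (functional_of_free \<mu>) * (norm g * C)"
      by (intro mult_left_mono norm_lip_pull_le norm_ge_zero)
    finally show ?thesis by (simp add: functional_of_free_map mult_ac)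
  qed
qed

lemma bounded_linear_free_map: "bounded_linear (free_map f)"
  by (rule bounded_linear_intro[where K = C])
     (simp_all add: linear_add[OF linear_free_map] linear_scale[OF linear_free_map]
       norm_free_map_le mult.commute)

end

lemma free_map_comp:
  assumes f: "C-lipschitz_on UNIV f" "f 0 = 0" and g: "D-lipschitz_on UNIV g" "g 0 = 0"
  shows "free_map g (free_map f \<mu>) = free_map (\<lambda>x. g (f x)) \<mu>"
proof -
  have gf: "(D * C)-lipschitz_on UNIV (\<lambda>x. g (f x))" "g (f 0) = 0"
    using lipschitz_on_compose2[OF f(1) lipschitz_on_subset[OF g(1)]] f g by auto
  have "lip_pull f (lip_pull g h) = lip_pull (\<lambda>x. g (f x)) h" for h
    by (rule lip0_eqI) (simp add: lip_pull_apply[OF f] lip_pull_apply[OF g] lip_pull_apply[OF gf])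
  then show ?thesis
    by (subst functional_of_free_inject[symmetric], intro blinfun_eqI)
       (simp add: functional_of_free_map[OF f] functional_of_free_map[OF g]
         functional_of_free_map[OF gf])
qed

lemma free_map_id: "free_map (\<lambda>x. x) \<mu> = \<mu>"
proof -
  have id: "1-lipschitz_on UNIV (\<lambda>x::'a. x)" by (simp add: lipschitz_on_def)
  have "lip_pull (\<lambda>x::'a. x) g = g" for g
    by (rule lip0_eqI) (simp add: lip_pull_apply[OF id])
  then show ?thesis
    by (subst functional_of_free_inject[symmetric], intro blinfun_eqI)
       (simp add: functional_of_free_map[OF id])
qed

text \<open>A constant map is 0-Lipschitz, so the norm estimate forces the push-forward to
  vanish.\<close>

lemma free_map_zero: "free_map (\<lambda>x. 0) \<mu> = 0"
  using norm_free_map_le[OF lipschitz_on_constant, of 0 \<mu>] by simp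

text \<open>Otherwise \<open>F\<close> stays below \<open>norm F - e\<close> on the unit ball, and
  by the symmetry of the ball so does its absolute value, contradicting the operator norm.\<close>

lemma blinfun_norming:
  fixes F :: "'a::real_normed_vector \<Rightarrow>\<^sub>L real"
  assumes "e > 0"
  obtains g where "norm g \<le> 1" "norm F \<le> F g + e"
proof (rule ccontr)
  assume "\<not> thesis"
  with that have less: "F g < norm F - e" if "norm g \<le> 1" for g
    using that by force
  from less[of 0] have pos: "norm F - e > 0" by (simp add: blinfun.zero_right)
  have "norm F \<le> norm F - e"
  proof (rule norm_blinfun_bound)
    show "norm (F x) \<le> (norm F - e) * norm x" for x
    proof (cases "x = 0")
      case False
      define y where "y = (1 / norm x) *\<^sub>R x"
      have "norm y \<le> 1" "norm (- y) \<le> 1" using False by (simp_all add: y_def)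
      from this[THEN less] have "\<bar>F y\<bar> \<le> norm F - e"
        by (simp add: blinfun.minus_right)
      then show ?thesis using False
        by (simp add: y_def blinfun.scaleR_right field_simps)
    qed (simp add: blinfun.zero_right)
  qed (use pos in simp)
  with assms show False by simp
qed

lemma lipschitz_on_of_sum_dist_le:
  fixes \<pi> :: "nat \<Rightarrow> 'a::metric_space \<Rightarrow> 'b::metric_space"
  assumes "0 \<le> C" and sum: "\<And>x y N. (\<Sum>n<N. dist (\<pi> n x) (\<pi> n y)) \<le> C * dist x y"
  shows "C-lipschitz_on UNIV (\<pi> n)"
proof (rule lipschitz_onI)
  show "dist (\<pi> n x) (\<pi> n y) \<le> C * dist x y" for x y
    using sum[where N = "Suc n" and x = x and y = y] sum_nonneg[of "{..<n}" "\<lambda>k. dist (\<pi> k x) (\<pi> k y)"] by simp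
qed (rule assms)

text \<open>
  Test the \<open>n\<close>-th summand against a norming \<open>g\<^sub>n\<close>; the hypothesis makes \<open>\<Sum>\<^sub>n g\<^sub>n \<circ> \<pi>\<^sub>n\<close> \<open>C\<close>-Lipschitz.
\<close>
lemma sum_norm_free_map_le:
  fixes \<pi> :: "nat \<Rightarrow> 'a::{metric_space, zero} \<Rightarrow> 'b::{metric_space, zero}"
  assumes C: "0 \<le> C" and sum: "\<And>x y N. (\<Sum>n<N. dist (\<pi> n x) (\<pi> n y)) \<le> C * dist x y"
    and zero: "\<And>n. \<pi> n 0 = 0"
  shows "(\<Sum>n<N. norm (free_map (\<pi> n) \<mu>)) \<le> C * norm \<mu>"
proof (rule field_le_epsilon)
  have lip: "C-lipschitz_on UNIV (\<pi> n)" for n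
    using C sum by (rule lipschitz_on_of_sum_dist_le)
  fix e :: real assume "e > 0"
  \<comment> \<open>The error \<open>e\<close> is shared among \<open>N\<close> summands; the
    \<open>+ 1\<close> covers \<open>N = 0\<close>.\<close>
  define d where "d = e / (real N + 1)"
  have "d > 0" using \<open>e > 0\<close> by (simp add: d_def)
  then have "\<exists>g. norm g \<le> 1 \<and>
      norm (functional_of_free (free_map (\<pi> n) \<mu>)) \<le> functional_of_free (free_map (\<pi> n) \<mu>) g + d" for n
    by (metis blinfun_norming)
  then obtain g where g: "\<And>n. norm (g n) \<le> 1"
    and gd: "\<And>n. norm (free_map (\<pi> n) \<mu>) \<le> functional_of_free \<mu> (lip_pull (\<pi> n) (g n)) + d"
    unfolding norm_free_space.rep_eq functional_of_free_map[OF lip zero] by metis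
  define h where "h = (\<Sum>n<N. lip_pull (\<pi> n) (g n))"
  have h_apply: "lip0_apply h x = (\<Sum>n<N. lip0_apply (g n) (\<pi> n x))" for x
    unfolding h_def
    by (induction N) (simp_all add: zero_lip0.rep_eq plus_lip0.rep_eq lip_pull_apply[OF lip zero])
  have "norm h \<le> C"
  proof (intro norm_lip0_le lipschitz_onI)
    fix x y
    have "dist (lip0_apply h x) (lip0_apply h y)
        \<le> (\<Sum>n<N. \<bar>lip0_apply (g n) (\<pi> n x) - lip0_apply (g n) (\<pi> n y)\<bar>)"
      unfolding h_apply dist_real_def sum_subtractf[symmetric] by (rule sum_abs)
    also have "\<dots> \<le> (\<Sum>n<N. dist (\<pi> n x) (\<pi> n y))"
    proof (rule sum_mono)
      show "\<bar>lip0_apply (g n) (\<pi> n x) - lip0_apply (g n) (\<pi> n y)\<bar> \<le> dist (\<pi> n x) (\<pi> n y)" for n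
        using lip0_apply_dist_le[of "g n" "\<pi> n x" "\<pi> n y"]
          mult_right_mono[OF g[of n] zero_le_dist[of "\<pi> n x" "\<pi> n y"]] by linarith
    qed
    also have "\<dots> \<le> C * dist x y" by (rule sum)
    finally show "dist (lip0_apply h x) (lip0_apply h y) \<le> C * dist x y" .
  qed (rule C)
  have "(\<Sum>n<N. norm (free_map (\<pi> n) \<mu>)) \<le> (\<Sum>n<N. functional_of_free \<mu> (lip_pull (\<pi> n) (g n)) + d)"
    by (intro sum_mono gd)
  also have "\<dots> = functional_of_free \<mu> h + real N * d"
    by (simp add: h_def blinfun.sum_right sum.distrib)
  also have "\<dots> \<le> C * norm \<mu> + e"
  proof (rule add_mono)
    have "functional_of_free \<mu> h \<le> norm (functional_of_free \<mu>) * norm h"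
      using norm_blinfun[of "functional_of_free \<mu>" h] by simp
    also have "\<dots> \<le> norm (functional_of_free \<mu>) * C"
      by (intro mult_left_mono \<open>norm h \<le> C\<close> norm_ge_zero)
    finally show "functional_of_free \<mu> h \<le> C * norm \<mu>"
      by (simp add: norm_free_space.rep_eq mult.commute)
    show "real N * d \<le> e" using \<open>e > 0\<close> by (simp add: d_def field_simps)
  qed
  finally show "(\<Sum>n<N. norm (free_map (\<pi> n) \<mu>)) \<le> C * norm \<mu> + e" .
qed


section \<open>Block structure of the integer grid\<close>

abbreviation grid_nth :: "l1_grid \<Rightarrow> nat \<Rightarrow> real"
  where "grid_nth x \<equiv> l1_nth (l1_of_grid x)"

lemma grid_eqI: "(\<And>k. grid_nth x k = grid_nth y k) \<Longrightarrow> x = y"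
  by (meson l1_of_grid_inject l1_sum_eqI)

lemma grid_nth_zero: "grid_nth 0 k = 0"
  by (simp add: zero_l1_grid.rep_eq zero_l1_sum.rep_eq)

lemma l1_nth_sum_basis:
  "l1_nth (\<Sum>n<N. c n *\<^sub>R l1_basis n) k = (if k < N then c k else 0)"
  by (induction N)
     (auto simp: zero_l1_sum.rep_eq plus_l1_sum.rep_eq scaleR_l1_sum.rep_eq l1_basis.rep_eq less_Suc_eq)

lemma grid_nth_Ints: "grid_nth x k \<in> \<int>"
  using l1_of_grid[of x] by (auto simp: l1_nth_sum_basis)

lemma finite_grid_support: "finite {k. grid_nth x k \<noteq> 0}"
proof -
  obtain N and a :: "nat \<Rightarrow> int" where "l1_of_grid x = (\<Sum>n<N. of_int (a n) *\<^sub>R l1_basis n)"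
    using l1_of_grid[of x] by auto
  then have "{k. grid_nth x k \<noteq> 0} \<subseteq> {..<N}" by (auto simp: l1_nth_sum_basis)
  then show ?thesis by (rule finite_subset) simp
qed

text \<open>Converse of the two preceding facts: grid points are exactly the finitely supported
  integer sequences, so they can be built coordinate by coordinate.\<close>

lemma grid_of_coordinates:
  assumes int: "\<And>k. f k \<in> \<int>" and fin: "finite {k. f k \<noteq> 0}"
  obtains x where "\<And>k. grid_nth x k = f k"
proof -
  from fin obtain N where N: "\<And>k. f k \<noteq> 0 \<Longrightarrow> k < N"
    by (auto simp: finite_nat_set_iff_bounded)
  \<comment> \<open>The floor only converts the type, since every \<open>f n\<close> is an
    integer.\<close>
  define y where "y = (\<Sum>n<N. of_int \<lfloor>f n\<rfloor> *\<^sub>R l1_basis n)"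
  have "l1_of_grid (Abs_l1_grid y) = y"
    by (rule Abs_l1_grid_inverse) (auto simp: y_def)
  moreover have "l1_nth y k = f k" for k
    using N int by (auto simp: y_def l1_nth_sum_basis)
  ultimately show ?thesis using that[of "Abs_l1_grid y"] by simp
qed

lemma grid_dist_eq: "dist x y = (\<Sum>k. \<bar>grid_nth x k - grid_nth y k\<bar>)"
  by (simp add: dist_l1_grid.rep_eq dist_norm norm_l1_sum.rep_eq minus_l1_sum.rep_eq)

lemma summable_grid_diff: "summable (\<lambda>k. \<bar>grid_nth x k - grid_nth y k\<bar>)"
  using summable_l1_nth[of "l1_of_grid x - l1_of_grid y"] by (simp add: minus_l1_sum.rep_eq)

lemma sum_grid_diff_le: "finite F \<Longrightarrow> (\<Sum>k\<in>F. \<bar>grid_nth x k - grid_nth y k\<bar>) \<le> dist x y"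
  unfolding grid_dist_eq by (intro sum_le_suminf summable_grid_diff) auto

text \<open>The \<open>n\<close>-th block is the set of all \<open>prod_encode (n, k)\<close>:
  \<open>\<pi> n\<close> reads the coordinates in it, \<open>s n\<close> writes a point into it and
  puts 0 elsewhere. Disjointness of the blocks gives the sum estimate.\<close>

lemma grid_blocks:
  obtains \<pi> s :: "nat \<Rightarrow> l1_grid \<Rightarrow> l1_grid"
  where "\<And>n. \<pi> n 0 = 0" "\<And>n. s n 0 = 0"
    "\<And>m n x. \<pi> m (s n x) = (if m = n then x else 0)"
    "\<And>x y N. (\<Sum>n<N. dist (\<pi> n x) (\<pi> n y)) \<le> dist x y"
    "\<And>n x y. dist (s n x) (s n y) \<le> dist x y"
proof -
  have "\<exists>z. \<forall>k. grid_nth z k = grid_nth x (prod_encode (n, k))" for n x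
  proof -
    have "finite ((\<lambda>k. prod_encode (n, k)) -` {k. grid_nth x k \<noteq> 0})"
      by (rule finite_vimageI[OF finite_grid_support]) (simp add: inj_def)
    then have "finite {k. grid_nth x (prod_encode (n, k)) \<noteq> 0}"
      by (simp add: vimage_def)
    then show ?thesis using grid_of_coordinates grid_nth_Ints by metis
  qed
  then have "\<forall>n x. \<exists>z. \<forall>k. grid_nth z k = grid_nth x (prod_encode (n, k))" by blast
  then obtain \<pi> where \<pi>: "\<And>n x k. grid_nth (\<pi> n x) k = grid_nth x (prod_encode (n, k))"
    unfolding choice_iff by blast
  have "\<exists>z. \<forall>j. grid_nth z j = (case prod_decode j of (m, k) \<Rightarrow> if m = n then grid_nth x k else 0)" for n x
  proof -
    let ?f = "\<lambda>j. case prod_decode j of (m, k) \<Rightarrow> if m = n then grid_nth x k else 0"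
    have "{j. ?f j \<noteq> 0} \<subseteq> (\<lambda>k. prod_encode (n, k)) ` {k. grid_nth x k \<noteq> 0}"
    proof
      fix j assume "j \<in> {j. ?f j \<noteq> 0}"
      moreover obtain m k where "j = prod_encode (m, k)"
        by (metis prod.collapse prod_decode_inverse)
      ultimately show "j \<in> (\<lambda>k. prod_encode (n, k)) ` {k. grid_nth x k \<noteq> 0}"
        by (auto split: if_splits)
    qed
    then have "finite {j. ?f j \<noteq> 0}"
      by (rule finite_subset) (intro finite_imageI finite_grid_support)
    moreover have "?f j \<in> \<int>" for j by (auto split: prod.split simp: grid_nth_Ints)
    ultimately show ?thesis using grid_of_coordinates[of ?f] by metis
  qed
  then obtain s where s: "\<And>n x j. grid_nth (s n x) j =
      (case prod_decode j of (m, k) \<Rightarrow> if m = n then grid_nth x k else 0)"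
    by metis
  show thesis
  proof
    show "\<pi> n 0 = 0" for n by (rule grid_eqI) (simp add: \<pi> grid_nth_zero)
    show "s n 0 = 0" for n by (rule grid_eqI) (simp add: s grid_nth_zero split: prod.split)
    show "\<pi> m (s n x) = (if m = n then x else 0)" for m n x
      by (rule grid_eqI) (simp add: \<pi> s grid_nth_zero)
    show "(\<Sum>n<N. dist (\<pi> n x) (\<pi> n y)) \<le> dist x y" for x y N
    proof -
      have "(\<Sum>n<N. dist (\<pi> n x) (\<pi> n y)) = (\<Sum>k. \<Sum>n<N. \<bar>grid_nth (\<pi> n x) k - grid_nth (\<pi> n y) k\<bar>)"
        unfolding grid_dist_eq by (rule suminf_sum[symmetric]) (rule summable_grid_diff)
      also have "\<dots> \<le> dist x y"
      proof (rule suminf_le_const)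
        show "summable (\<lambda>k. \<Sum>n<N. \<bar>grid_nth (\<pi> n x) k - grid_nth (\<pi> n y) k\<bar>)"
          by (rule summable_sum) (rule summable_grid_diff)
        fix L
        \<comment> \<open>Injectivity of \<open>prod_encode\<close> turns the rectangle of pairs
          into a finite set of distinct coordinates, whose contribution is at most
          \<open>dist x y\<close>.\<close>
        have "(\<Sum>k<L. \<Sum>n<N. \<bar>grid_nth (\<pi> n x) k - grid_nth (\<pi> n y) k\<bar>)
            = (\<Sum>p\<in>{..<N} \<times> {..<L}. \<bar>grid_nth x (prod_encode p) - grid_nth y (prod_encode p)\<bar>)"
          unfolding \<pi> by (subst sum.swap) (simp add: sum.cartesian_product case_prod_beta)
        also have "\<dots> = (\<Sum>j\<in>prod_encode ` ({..<N} \<times> {..<L}). \<bar>grid_nth x j - grid_nth y j\<bar>)"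
          by (simp add: sum.reindex inj_prod_encode)
        also have "\<dots> \<le> dist x y" by (rule sum_grid_diff_le) simp
        finally show "(\<Sum>k<L. \<Sum>n<N. \<bar>grid_nth (\<pi> n x) k - grid_nth (\<pi> n y) k\<bar>) \<le> dist x y" .
      qed
      finally show ?thesis .
    qed
    show "dist (s n x) (s n y) \<le> dist x y" for n x y
      unfolding grid_dist_eq[of "s n x"]
    proof (rule suminf_le_const[OF summable_grid_diff])
      fix L
      \<comment> \<open>Only indices in block \<open>n\<close> contribute, and on these the second
        decoded component is injective.\<close>
      let ?B = "{j. j < L \<and> fst (prod_decode j) = n}"
      have "(\<Sum>j<L. \<bar>grid_nth (s n x) j - grid_nth (s n y) j\<bar>)
          = (\<Sum>j\<in>?B. \<bar>grid_nth x (snd (prod_decode j)) - grid_nth y (snd (prod_decode j))\<bar>)"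
        by (rule sum.mono_neutral_cong_right) (auto simp: s case_prod_beta)
      also have "\<dots> = (\<Sum>k\<in>(\<lambda>j. snd (prod_decode j)) ` ?B. \<bar>grid_nth x k - grid_nth y k\<bar>)"
      proof (subst sum.reindex)
        show "inj_on (\<lambda>j. snd (prod_decode j)) ?B"
          by (auto simp: inj_on_def) (metis prod.collapse prod_decode_eq)
      qed simp
      also have "\<dots> \<le> dist x y" by (rule sum_grid_diff_le) simp
      finally show "(\<Sum>j<L. \<bar>grid_nth (s n x) j - grid_nth (s n y) j\<bar>) \<le> dist x y" .
    qed
  qed
qed

section \<open>Transfer of the block structure to the free space, followed by decomposition\<close>

theorem theorem3p11:
  shows "\<exists>T :: l1_grid free_space \<Rightarrow> l1_grid free_space l1_sum.
           bij T \<and> bounded_linear T \<and> bounded_linear (inv T)"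
proof -
  obtain \<pi> s :: "nat \<Rightarrow> l1_grid \<Rightarrow> l1_grid" where
    \<pi>0: "\<And>n. \<pi> n 0 = 0" and s0: "\<And>n. s n 0 = 0"
    and \<pi>s: "\<And>m n x. \<pi> m (s n x) = (if m = n then x else 0)"
    and \<pi>_sum: "\<And>x y N. (\<Sum>n<N. dist (\<pi> n x) (\<pi> n y)) \<le> dist x y"
    and s_dist: "\<And>n x y. dist (s n x) (s n y) \<le> dist x y"
    using grid_blocks by blast
  have \<pi>: "1-lipschitz_on UNIV (\<pi> n)" for n
    by (rule lipschitz_on_of_sum_dist_le) (simp_all add: \<pi>_sum)
  have s: "1-lipschitz_on UNIV (s n)" for n
    by (rule lipschitz_onI) (simp_all add: s_dist)
  obtain P where P: "bounded_linear P" and P_nth: "\<And>\<mu> n. l1_nth (P \<mu>) n = free_map (\<pi> n) \<mu>"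
    using bounded_linear_into_l1_sum[of "\<lambda>n. free_map (\<pi> n)" 1]
      linear_free_map[OF \<pi> \<pi>0] sum_norm_free_map_le[of 1 \<pi>] \<pi>_sum \<pi>0 by auto
  define J where "J u = (\<Sum>n. free_map (s n) (l1_nth u n))" for u
  note J_sum = bounded_linear_from_l1_sum[of "\<lambda>n. free_map (s n)" 1,
      OF linear_free_map[OF s s0] norm_free_map_le[OF s s0]]
  have J: "bounded_linear J"
    unfolding J_def by (rule J_sum(2))
  have "P (J u) = u" for u
  proof (rule l1_sum_eqI)
    fix m
    \<comment> \<open>The bounded push-forward along \<open>\<pi> m\<close> passes through the
      series; functoriality then leaves the identity for \<open>n = m\<close> and the zero map for
      all other \<open>n\<close>.\<close>
    have "l1_nth (P (J u)) m = (\<Sum>n. free_map (\<pi> m) (free_map (s n) (l1_nth u n)))"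
      unfolding P_nth J_def
      by (rule bounded_linear.suminf[OF bounded_linear_free_map[OF \<pi> \<pi>0] J_sum(1)])
    also have "\<dots> = (\<Sum>n. if n = m then l1_nth u n else 0)"
      by (intro suminf_cong)
         (auto simp: free_map_comp[OF s s0 \<pi> \<pi>0] \<pi>s free_map_id free_map_zero)
    also have "\<dots> = l1_nth u m"
      by (rule sums_unique[symmetric]) (rule sums_single)
    finally show "l1_nth (P (J u)) m = l1_nth u m" .
  qed
  then show ?thesis by (rule pelczynski_decomposition[OF P J])
qed

end
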